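(* Let $G$ be a nonzero proper subgroup of $\mathbb{Q}$, and let $S_G$ be the set of primes $p$ such that $G$ is $p$-divisible. Let $q$ be the largest odd integer which divides $p-1$ for all primes $p\notin S_G$. Then the Grothendieck ring $K_0(G;+,<)$ of the ordered abelian group $(G;+,<)$ is (isomorphic to) a quotient ring of $(\mathbb{Z}/q\mathbb{Z})[T]/(T+T^2)$.
   Context: $G$ is $p$-divisible if for every $x\in G$ there is $y\in G$ with $p\cdot y=x$. The order on $G$ is the one induced from $\mathbb{Q}$. Grothendieck ring: for a first-order structure $\mathcal{M}$ with underlying set $M$, let $\mathrm{Def}(\mathcal{M})$ be the family of all subsets of $M^n$ ($n\geq 0$ arbitrary) definable in $\mathcal{M}$ with parameters. Two definable sets are definably isomorphic if there is a definable (with parameters) bijection between them. The Grothendieck group of $\mathcal{M}$ is the abelian group generated by symbols $[X]$, $X\in\mathrm{Def}(\mathcal{M})$, subject to the relations $[X]=[Y]$ whenever $X$ and $Y$ are definably isomorphic, and $[X\cup Y]=[X]+[Y]$ whenever $X\cap Y=\emptyset$. With the multiplication $[X][Y]=[X\times Y]$ it becomes a commutative ring, the Grothendieck ring $K_0(\mathcal{M})$. A quotient is allowed to be the zero ring. *)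

theory Defs
  imports "HOL-Algebra.Free_Abelian_Groups" "HOL-Algebra.IntRing" "HOL-Algebra.UnivPoly"
    "HOL-Computational_Algebra.Primes"
begin

section \<open>First-order structures and definable sets\<close>

datatype 'f fo_term = Var nat | App 'f "'f fo_term list"

text \<open>Formulas use de Bruijn indices: \<^term>\<open>Var 0\<close> is the variable bound by the innermost
  quantifier.\<close>

datatype ('f, 'r) fo_formula =
    Equal "'f fo_term" "'f fo_term"
  | Rel 'r "'f fo_term list"
  | Neg "('f, 'r) fo_formula"
  | Conj "('f, 'r) fo_formula" "('f, 'r) fo_formula"
  | Exi "('f, 'r) fo_formula"

text \<open>The language consists of all symbols of the types \<open>'f\<close> and \<open>'r\<close>. Only the values of
  \<open>fun_interp\<close> and \<open>rel_interp\<close> on argument lists over the universe whose length is the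
  prescribed arity matter.\<close>

record ('a, 'f, 'r) fo_struct =
  universe :: "'a set"
  fun_arity :: "'f \<Rightarrow> nat"
  rel_arity :: "'r \<Rightarrow> nat"
  fun_interp :: "'f \<Rightarrow> 'a list \<Rightarrow> 'a"
  rel_interp :: "'r \<Rightarrow> 'a list \<Rightarrow> bool"

text \<open>\<open>wf_term M k t\<close> and \<open>wf_formula M k \<phi>\<close>: the arities are respected and all free variables
  are among the first \<open>k\<close>.\<close>

fun wf_term :: "('a, 'f, 'r) fo_struct \<Rightarrow> nat \<Rightarrow> 'f fo_term \<Rightarrow> bool" where
  "wf_term M k (Var i) \<longleftrightarrow> i < k"
| "wf_term M k (App f ts) \<longleftrightarrow>
     length ts = fun_arity M f \<and> (\<forall>t \<in> set ts. wf_term M k t)"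

primrec wf_formula :: "('a, 'f, 'r) fo_struct \<Rightarrow> nat \<Rightarrow> ('f, 'r) fo_formula \<Rightarrow> bool" where
  "wf_formula M k (Equal s t) \<longleftrightarrow> wf_term M k s \<and> wf_term M k t"
| "wf_formula M k (Rel r ts) \<longleftrightarrow> length ts = rel_arity M r \<and> (\<forall>t \<in> set ts. wf_term M k t)"
| "wf_formula M k (Neg \<phi>) \<longleftrightarrow> wf_formula M k \<phi>"
| "wf_formula M k (Conj \<phi> \<psi>) \<longleftrightarrow> wf_formula M k \<phi> \<and> wf_formula M k \<psi>"
| "wf_formula M k (Exi \<phi>) \<longleftrightarrow> wf_formula M (Suc k) \<phi>"

primrec eval_term :: "('a, 'f, 'r) fo_struct \<Rightarrow> 'a list \<Rightarrow> 'f fo_term \<Rightarrow> 'a" where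
  "eval_term M e (Var i) = e ! i"
| "eval_term M e (App f ts) = fun_interp M f (map (eval_term M e) ts)"

primrec sat :: "('a, 'f, 'r) fo_struct \<Rightarrow> 'a list \<Rightarrow> ('f, 'r) fo_formula \<Rightarrow> bool" where
  "sat M e (Equal s t) \<longleftrightarrow> eval_term M e s = eval_term M e t"
| "sat M e (Rel r ts) \<longleftrightarrow> rel_interp M r (map (eval_term M e) ts)"
| "sat M e (Neg \<phi>) \<longleftrightarrow> \<not> sat M e \<phi>"
| "sat M e (Conj \<phi> \<psi>) \<longleftrightarrow> sat M e \<phi> \<and> sat M e \<psi>"
| "sat M e (Exi \<phi>) \<longleftrightarrow> (\<exists>a \<in> universe M. sat M (a # e) \<phi>)"

text \<open>An element of \<open>M\<^sup>n\<close> is a list of length \<open>n\<close>; \<open>ps\<close> is the list of parameters.\<close>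

definition definable :: "('a, 'f, 'r) fo_struct \<Rightarrow> nat \<Rightarrow> 'a list set \<Rightarrow> bool" where
  "definable M n X \<longleftrightarrow> (\<exists>\<phi> ps. set ps \<subseteq> universe M \<and> wf_formula M (n + length ps) \<phi> \<and>
     X = {xs. length xs = n \<and> set xs \<subseteq> universe M \<and> sat M (xs @ ps) \<phi>})"

definition Def :: "('a, 'f, 'r) fo_struct \<Rightarrow> 'a list set set" where
  "Def M = {X. \<exists>n. definable M n X}"

text \<open>A map is definable if its graph, viewed as a subset of \<open>M\<^sup>m\<^sup>+\<^sup>n\<close>, is.\<close>

definition definably_isomorphic ::
    "('a, 'f, 'r) fo_struct \<Rightarrow> 'a list set \<Rightarrow> 'a list set \<Rightarrow> bool" where
  "definably_isomorphic M X Y \<longleftrightarrow> (\<exists>m n f. definable M m X \<and> definable M n Y \<and>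
     bij_betw f X Y \<and> definable M (m + n) ((\<lambda>x. x @ f x) ` X))"


section \<open>The Grothendieck ring\<close>

definition cart_prod :: "'a list set \<Rightarrow> 'a list set \<Rightarrow> 'a list set" where
  "cart_prod X Y = {x @ y | x y. x \<in> X \<and> y \<in> Y}"

text \<open>The free abelian group on \<^term>\<open>Def M\<close>, with the bilinear multiplication that is given on
  generators by \<open>[X][Y] = [X \<times> Y]\<close>. The unit is the class of the one-point set \<open>M\<^sup>0\<close>.\<close>

definition free_def_ring :: "('a, 'f, 'r) fo_struct \<Rightarrow> ('a list set \<Rightarrow>\<^sub>0 int) ring" where
  "free_def_ring M =
     \<lparr>carrier = carrier (free_Abelian_group (Def M)),
      monoid.mult = (\<lambda>a b. frag_extend (\<lambda>X. frag_extend (\<lambda>Y. frag_of (cart_prod X Y)) b) a),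
      one = frag_of {[]},
      zero = 0,
      add = (+)\<rparr>"

definition grothendieck_relations ::
    "('a, 'f, 'r) fo_struct \<Rightarrow> ('a list set \<Rightarrow>\<^sub>0 int) set" where
  "grothendieck_relations M =
     {frag_of X - frag_of Y | X Y. definably_isomorphic M X Y} \<union>
     {frag_of (X \<union> Y) - (frag_of X + frag_of Y) | X Y.
        (\<exists>n. definable M n X \<and> definable M n Y) \<and> X \<inter> Y = {}}"

text \<open>The subgroup generated by the relations is an ideal of \<^term>\<open>free_def_ring M\<close>, so the
  quotient by it is the Grothendieck group with the induced multiplication.\<close>

definition grothendieck_ring ::
    "('a, 'f, 'r) fo_struct \<Rightarrow> ('a list set \<Rightarrow>\<^sub>0 int) set ring" where
  "grothendieck_ring M =
     free_def_ring M Quot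
       generate (free_Abelian_group (Def M)) (grothendieck_relations M)"


section \<open>Ordered subgroups of the rationals\<close>

datatype og_fun = Plus
datatype og_rel = Less

definition ordered_group_struct :: "rat set \<Rightarrow> (rat, og_fun, og_rel) fo_struct" where
  "ordered_group_struct G =
     \<lparr>universe = G,
      fun_arity = (\<lambda>_. 2),
      rel_arity = (\<lambda>_. 2),
      fun_interp = (\<lambda>_ xs. xs ! 0 + xs ! 1),
      rel_interp = (\<lambda>_ xs. xs ! 0 < xs ! 1)\<rparr>"

definition rational_group :: "rat monoid" where
  "rational_group = \<lparr>carrier = UNIV, monoid.mult = (+), one = 0\<rparr>"

definition p_divisible :: "nat \<Rightarrow> rat set \<Rightarrow> bool" where
  "p_divisible p G \<longleftrightarrow> (\<forall>x \<in> G. \<exists>y \<in> G. of_nat p * y = x)"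


section \<open>The ring \<open>(\<int>/q\<int>)[T]/(T + T\<^sup>2)\<close>\<close>

definition poly_T :: "int \<Rightarrow> nat \<Rightarrow> int set" where
  "poly_T q = up_ring.monom (UP (ZFact q)) \<one>\<^bsub>ZFact q\<^esub> 1"

definition target_ring :: "int \<Rightarrow> (nat \<Rightarrow> int set) set ring" where
  "target_ring q =
     UP (ZFact q) Quot
       (Idl\<^bsub>UP (ZFact q)\<^esub> {poly_T q \<oplus>\<^bsub>UP (ZFact q)\<^esub> poly_T q [^]\<^bsub>UP (ZFact q)\<^esub> (2::nat)})"

end

theory Submission
  imports Defs
begin

text \<open>
  The Grothendieck ring of \<open>(G; +, <)\<close> is in fact the zero ring, and therefore it is the
  quotient of the target ring by its unit ideal. What has to be shown is \<open>1 = 0\<close>, that is,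
  that the class of a point vanishes; multiplying with \<open>[Y]\<close> then kills every class
  (\<open>null_if_null_point\<close>). The class of the plane \<open>G\<^sup>2\<close> is computed in two ways.

  Let \<open>p\<close> be the least prime by which \<open>G\<close> is not divisible. It exists because
  \<open>G\<close> is neither \<open>0\<close> nor \<open>\<rat>\<close>. Then multiplication by \<open>k = p - 1\<close> is a
  bijection of \<open>G\<close>, and there is \<open>a\<close> in \<open>G\<close> with \<open>a/p\<close> outside
  \<open>G\<close>. The cut at \<open>a/p\<close> behaves like an endpoint that costs nothing: \<open>G\<close> is the
  union of the two half-lines \<open>x < a/p\<close> and \<open>x > a/p\<close>, and \<open>x \<mapsto> a - k x\<close>
  exchanges them, as it maps \<open>G\<close> onto \<open>G\<close> and fixes \<open>a/p\<close>.

  Let \<open>w\<close> be the class of such a half-line. The line \<open>x - y = a/p\<close> misses \<open>G\<^sup>2\<close>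
  and splits the quadrant \<open>x > 2a/p\<close>, \<open>y > a/p\<close>, whose class is \<open>v w\<close>, say,
  into a piece of class \<open>w w\<close> and a piece of class \<open>v w\<close>. Hence \<open>w w = 0\<close>
  (\<open>null_corner\<close>). The plane consists of four quadrants of class \<open>w w\<close>, so
  \<open>[G\<^sup>2] = 0\<close> (\<open>null_plane\<close>).

  On the other hand, a half-open quadrant \<open>x > 0\<close>, \<open>y \<ge> 0\<close> is the disjoint union of
  two sheared copies of itself and has class \<open>0\<close>. Four rotated copies of it make up the plane
  without the origin, so \<open>[G\<^sup>2] = 1\<close> (\<open>null_punctured_plane\<close>).
\<close>

section \<open>Closure properties of definable sets\<close>

definition tuples :: "('a, 'f, 'r) fo_struct \<Rightarrow> nat \<Rightarrow> 'a list set" where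
  "tuples M n = {xs. length xs = n \<and> set xs \<subseteq> universe M}"

text \<open>Pulling a definable set back along a map of coordinates, and merging the parameter lists of two
formulas, both amount to renaming free variables.\<close>

primrec rename_term :: "(nat \<Rightarrow> nat) \<Rightarrow> 'f fo_term \<Rightarrow> 'f fo_term" where
  "rename_term \<rho> (Var i) = Var (\<rho> i)"
| "rename_term \<rho> (App f ts) = App f (map (rename_term \<rho>) ts)"

primrec rename_formula :: "('f, 'r) fo_formula \<Rightarrow> (nat \<Rightarrow> nat) \<Rightarrow> ('f, 'r) fo_formula" where
  "rename_formula (Equal s t) \<rho> = Equal (rename_term \<rho> s) (rename_term \<rho> t)"
| "rename_formula (Rel r ts) \<rho> = Rel r (map (rename_term \<rho>) ts)"
| "rename_formula (Neg \<phi>) \<rho> = Neg (rename_formula \<phi> \<rho>)"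
| "rename_formula (Conj \<phi> \<psi>) \<rho> = Conj (rename_formula \<phi> \<rho>) (rename_formula \<psi> \<rho>)"
| "rename_formula (Exi \<phi>) \<rho> = Exi (rename_formula \<phi> (case_nat 0 (Suc \<circ> \<rho>)))"

lemma wf_rename_term:
  assumes "wf_term M k t" "\<And>i. i < k \<Longrightarrow> \<rho> i < l"
  shows "wf_term M l (rename_term \<rho> t)"
  using assms by (induction t) auto

lemma eval_rename_term:
  assumes "wf_term M k t" "\<And>i. i < k \<Longrightarrow> d ! i = e ! \<rho> i"
  shows "eval_term M e (rename_term \<rho> t) = eval_term M d t"
  using assms by (induction t) (auto simp: comp_def cong: map_cong)

lemma wf_rename_formula:
  assumes "wf_formula M k \<phi>" "\<And>i. i < k \<Longrightarrow> \<rho> i < l"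
  shows "wf_formula M l (rename_formula \<phi> \<rho>)"
  using assms
proof (induction \<phi> arbitrary: k l \<rho>)
  case (Exi \<phi>)
  have "wf_formula M (Suc l) (rename_formula \<phi> (case_nat 0 (Suc \<circ> \<rho>)))"
    by (rule Exi.IH[of "Suc k"]) (use Exi.prems in \<open>auto split: nat.split\<close>)
  then show ?case by simp
qed (auto intro: wf_rename_term)

lemma sat_rename_formula:
  assumes "wf_formula M k \<phi>" "\<And>i. i < k \<Longrightarrow> d ! i = e ! \<rho> i"
  shows "sat M e (rename_formula \<phi> \<rho>) \<longleftrightarrow> sat M d \<phi>"
  using assms
proof (induction \<phi> arbitrary: k d e \<rho>)
  case (Equal s t)
  then show ?case by (simp add: eval_rename_term[of M k _ d e \<rho>])
next
  case (Rel r ts)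
  then have "map (eval_term M e) (map (rename_term \<rho>) ts) = map (eval_term M d) ts"
    by (auto simp: eval_rename_term[of M k _ d e \<rho>])
  then show ?case by (metis rename_formula.simps(2) sat.simps(2))
next
  case (Neg \<phi>)
  show ?case using Neg.IH[of k d e \<rho>] Neg.prems by simp
next
  case (Conj \<phi> \<psi>)
  show ?case using Conj.IH(1)[of k d e \<rho>] Conj.IH(2)[of k d e \<rho>] Conj.prems by simp
next
  case (Exi \<phi>)
  have "sat M (a # e) (rename_formula \<phi> (case_nat 0 (Suc \<circ> \<rho>))) = sat M (a # d) \<phi>" for a
    by (rule Exi.IH[of "Suc k"]) (use Exi.prems in \<open>auto split: nat.split\<close>)
  then show ?case by simp
qed

lemma definableI:
  assumes "set ps \<subseteq> universe M" "wf_formula M (n + length ps) \<phi>"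
    and "\<And>xs. xs \<in> tuples M n \<Longrightarrow> xs \<in> X \<longleftrightarrow> sat M (xs @ ps) \<phi>" "X \<subseteq> tuples M n"
  shows "definable M n X"
  unfolding definable_def
  by (rule exI[of _ \<phi>], rule exI[of _ ps]) (use assms in \<open>auto simp: tuples_def\<close>)

lemma definableE:
  assumes "definable M n X"
  obtains \<phi> ps where "set ps \<subseteq> universe M" "wf_formula M (n + length ps) \<phi>"
    "\<And>xs. xs \<in> tuples M n \<Longrightarrow> xs \<in> X \<longleftrightarrow> sat M (xs @ ps) \<phi>" "X \<subseteq> tuples M n"
proof -
  obtain \<phi> ps where "set ps \<subseteq> universe M" "wf_formula M (n + length ps) \<phi>"
    "X = {xs. length xs = n \<and> set xs \<subseteq> universe M \<and> sat M (xs @ ps) \<phi>}"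
    using assms unfolding definable_def by blast
  then show thesis by (intro that[of ps \<phi>]) (auto simp: tuples_def)
qed

lemma definable_subset: "definable M n X \<Longrightarrow> X \<subseteq> tuples M n"
  by (erule definableE)

text \<open>The tautology must be well-formed when neither variables nor parameters are available, hence the
closed subformula.\<close>

lemma definable_tuples: "definable M n (tuples M n)"
proof (rule definableI)
  let ?\<phi> = "Exi (Equal (Var 0) (Var 0))"
  show "wf_formula M (n + length []) (Neg (Conj ?\<phi> (Neg ?\<phi>)))" by simp
qed auto

text \<open>Substituting coordinates for coordinates, in particular permuting or duplicating them.\<close>

lemma definable_pullback:
  assumes "definable M n X" "\<And>i. i < n \<Longrightarrow> \<sigma> i < m"
  shows "definable M m {xs \<in> tuples M m. map (\<lambda>i. xs ! \<sigma> i) [0..<n] \<in> X}"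
proof -
  obtain \<phi> ps where ps: "set ps \<subseteq> universe M" and wf: "wf_formula M (n + length ps) \<phi>"
    and X: "\<And>xs. xs \<in> tuples M n \<Longrightarrow> xs \<in> X \<longleftrightarrow> sat M (xs @ ps) \<phi>"
    using assms(1) by (metis definableE)
  let ?\<rho> = "\<lambda>i. if i < n then \<sigma> i else i - n + m"
  show ?thesis
  proof (rule definableI)
    show "wf_formula M (m + length ps) (rename_formula \<phi> ?\<rho>)"
      by (rule wf_rename_formula[OF wf]) (use assms(2) in \<open>auto intro: trans_less_add1\<close>)
    fix xs assume xs: "xs \<in> tuples M m"
    have "map (\<lambda>i. xs ! \<sigma> i) [0..<n] \<in> tuples M n"
      using xs assms(2) by (auto simp: tuples_def)
    moreover have "sat M (xs @ ps) (rename_formula \<phi> ?\<rho>) =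
        sat M (map (\<lambda>i. xs ! \<sigma> i) [0..<n] @ ps) \<phi>"
      by (rule sat_rename_formula[OF wf]) (use xs assms(2) in \<open>auto simp: tuples_def nth_append\<close>)
    ultimately show "xs \<in> {xs \<in> tuples M m. map (\<lambda>i. xs ! \<sigma> i) [0..<n] \<in> X} \<longleftrightarrow>
        sat M (xs @ ps) (rename_formula \<phi> ?\<rho>)"
      using X xs by simp
  qed (use ps in auto)
qed

lemma definable_Int:
  assumes "definable M n X" "definable M n Y"
  shows "definable M n (X \<inter> Y)"
proof -
  obtain \<phi> ps where ps: "set ps \<subseteq> universe M" "wf_formula M (n + length ps) \<phi>"
    and X: "\<And>xs. xs \<in> tuples M n \<Longrightarrow> xs \<in> X \<longleftrightarrow> sat M (xs @ ps) \<phi>" "X \<subseteq> tuples M n"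
    using assms(1) by (metis definableE)
  obtain \<psi> qs where qs: "set qs \<subseteq> universe M" "wf_formula M (n + length qs) \<psi>"
    and Y: "\<And>xs. xs \<in> tuples M n \<Longrightarrow> xs \<in> Y \<longleftrightarrow> sat M (xs @ qs) \<psi>"
    using assms(2) by (metis definableE)
  let ?\<rho> = "\<lambda>i. if i < n then i else i + length ps"
  let ?\<chi> = "Conj (rename_formula \<phi> id) (rename_formula \<psi> ?\<rho>)"
  show ?thesis
  proof (rule definableI)
    show "set (ps @ qs) \<subseteq> universe M" using ps qs by auto
    show "wf_formula M (n + length (ps @ qs)) ?\<chi>"
      using wf_rename_formula[OF ps(2), of id "n + length (ps @ qs)"]
        wf_rename_formula[OF qs(2), of ?\<rho> "n + length (ps @ qs)"] by auto
    fix xs assume xs: "xs \<in> tuples M n"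
    have "sat M (xs @ ps @ qs) (rename_formula \<phi> id) = sat M (xs @ ps) \<phi>"
      by (rule sat_rename_formula[OF ps(2)]) (use xs in \<open>auto simp: nth_append tuples_def\<close>)
    moreover have "sat M (xs @ ps @ qs) (rename_formula \<psi> ?\<rho>) = sat M (xs @ qs) \<psi>"
      by (rule sat_rename_formula[OF qs(2)]) (use xs in \<open>auto simp: nth_append tuples_def\<close>)
    ultimately show "xs \<in> X \<inter> Y \<longleftrightarrow> sat M (xs @ ps @ qs) ?\<chi>"
      using X Y xs by simp
  qed (use X in auto)
qed

lemma definable_Diff:
  assumes "definable M n X" "definable M n Y"
  shows "definable M n (X - Y)"
proof -
  obtain \<psi> qs where qs: "set qs \<subseteq> universe M" "wf_formula M (n + length qs) \<psi>"
    and Y: "\<And>xs. xs \<in> tuples M n \<Longrightarrow> xs \<in> Y \<longleftrightarrow> sat M (xs @ qs) \<psi>"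
    using assms(2) by (metis definableE)
  have "definable M n (tuples M n - Y)"
    by (rule definableI[OF qs(1), of _ "Neg \<psi>"]) (use qs Y in auto)
  from definable_Int[OF assms(1) this] show ?thesis
    using definable_subset[OF assms(1)] by (simp add: Int_Diff [symmetric] Int_absorb2)
qed

lemma definable_Un:
  assumes "definable M n X" "definable M n Y"
  shows "definable M n (X \<union> Y)"
proof -
  have "definable M n (tuples M n - ((tuples M n - X) - Y))"
    by (intro definable_Diff definable_tuples assms)
  also have "tuples M n - ((tuples M n - X) - Y) = X \<union> Y"
    using assms[THEN definable_subset] by blast
  finally show ?thesis .
qed

lemma definable_equal:
  assumes "i < n" "j < n"
  shows "definable M n {xs \<in> tuples M n. xs ! i = xs ! j}"
  by (rule definableI[of "[]" _ _ "Equal (Var i) (Var j)"]) (use assms in auto)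

lemma tuples_append_cases:
  assumes "zs \<in> tuples M (m + n)"
  obtains x y where "zs = x @ y" "x \<in> tuples M m" "y \<in> tuples M n"
proof
  show "zs = take m zs @ drop m zs" by simp
qed (use assms set_take_subset[of m zs] set_drop_subset[of m zs] in \<open>auto simp: tuples_def\<close>)

lemma definable_cart_prod:
  assumes X: "definable M m X" and Y: "definable M n Y"
  shows "definable M (m + n) (cart_prod X Y)"
proof -
  let ?A = "{xs \<in> tuples M (m + n). map (\<lambda>i. xs ! id i) [0..<m] \<in> X}"
  let ?B = "{xs \<in> tuples M (m + n). map (\<lambda>i. xs ! (m + i)) [0..<n] \<in> Y}"
  have "definable M (m + n) (?A \<inter> ?B)"
    by (intro definable_Int definable_pullback X Y) auto
  moreover have "?A \<inter> ?B = cart_prod X Y"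
  proof -
    have "zs \<in> ?A \<inter> ?B \<longleftrightarrow> zs \<in> cart_prod X Y" if "zs \<in> tuples M (m + n)" for zs
    proof -
      from that obtain x y where zs: "zs = x @ y" "x \<in> tuples M m" "y \<in> tuples M n"
        by (rule tuples_append_cases)
      have "map (\<lambda>i. zs ! id i) [0..<m] = x" "map (\<lambda>i. zs ! (m + i)) [0..<n] = y"
        using zs by (auto simp: tuples_def nth_append intro!: nth_equalityI)
      moreover have "zs \<in> cart_prod X Y \<longleftrightarrow> x \<in> X \<and> y \<in> Y"
        using zs definable_subset[OF X] by (auto simp: cart_prod_def tuples_def)
      ultimately show ?thesis using that by simp
    qed
    moreover have "cart_prod X Y \<subseteq> tuples M (m + n)"
      using definable_subset[OF X] definable_subset[OF Y]
      by (fastforce simp: cart_prod_def tuples_def)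
    ultimately show ?thesis by blast
  qed
  ultimately show ?thesis by simp
qed

lemma definable_diagonal:
  assumes Y: "definable M n Y"
  shows "definable M (n + n) ((\<lambda>y. y @ y) ` Y)"
proof -
  let ?E = "\<lambda>l. {zs \<in> tuples M (n + n). \<forall>j<l. zs ! j = zs ! (n + j)}"
  have "l \<le> n \<Longrightarrow> definable M (n + n) (?E l)" for l
  proof (induction l)
    case 0
    then show ?case using definable_tuples by simp
  next
    case (Suc l)
    then have "definable M (n + n)
        (?E l \<inter> {zs \<in> tuples M (n + n). zs ! l = zs ! (n + l)})"
      by (intro definable_Int definable_equal) auto
    moreover have "?E l \<inter> {zs \<in> tuples M (n + n). zs ! l = zs ! (n + l)} = ?E (Suc l)"
      by (auto simp: less_Suc_eq)
    ultimately show ?case by simp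
  qed
  then have "definable M (n + n) (cart_prod Y Y \<inter> ?E n)"
    by (intro definable_Int definable_cart_prod Y) auto
  moreover have "cart_prod Y Y \<inter> ?E n = (\<lambda>y. y @ y) ` Y"
  proof -
    have "x = y" if "x @ y \<in> ?E n" "x \<in> Y" "y \<in> Y" for x y
      using that definable_subset[OF Y]
      by (intro nth_equalityI) (auto simp: tuples_def nth_append)
    then have "cart_prod Y Y \<inter> ?E n \<subseteq> (\<lambda>y. y @ y) ` Y"
      by (auto simp: cart_prod_def)
    moreover have "y @ y \<in> ?E n" if "y \<in> Y" for y
      using that definable_subset[OF Y] by (auto simp: tuples_def nth_append subset_iff)
    then have "(\<lambda>y. y @ y) ` Y \<subseteq> cart_prod Y Y \<inter> ?E n"
      by (auto simp: cart_prod_def)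
    ultimately show ?thesis by (rule equalityI)
  qed
  ultimately show ?thesis by simp
qed

text \<open>The graph of \<open>f \<times> id\<close> is the product of the graph of \<open>f\<close> with the diagonal
of \<open>Y\<close>, up to a permutation of the coordinates.\<close>

lemma definably_isomorphic_cart_prod:
  assumes "definably_isomorphic M X X'" and Y: "definable M k Y"
  shows "definably_isomorphic M (cart_prod X Y) (cart_prod X' Y)"
proof -
  obtain m n f where X: "definable M m X" and X': "definable M n X'"
    and f: "bij_betw f X X'" and gr: "definable M (m + n) ((\<lambda>x. x @ f x) ` X)"
    using assms(1) unfolding definably_isomorphic_def by auto
  have lX: "length x = m" if "x \<in> X" for x
    using definable_subset[OF X] that by (auto simp: tuples_def)
  have lX': "length x = n" if "x \<in> X'" for x
    using definable_subset[OF X'] that by (auto simp: tuples_def)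
  have lY: "length y = k" if "y \<in> Y" for y
    using definable_subset[OF Y] that by (auto simp: tuples_def)
  have fX: "f x \<in> X'" if "x \<in> X" for x
    using f that by (auto simp: bij_betw_def)
  define F where "F = (\<lambda>z. f (take m z) @ drop m z)"
  have F: "F (x @ y) = f x @ y" if "x \<in> X" for x y
    using lX[OF that] by (simp add: F_def)
  \<comment> \<open>This permutation reads \<open>(x, y, u, v)\<close> as \<open>(x, u, y, v)\<close>, for blocks of the
  lengths \<open>m\<close>, \<open>k\<close>, \<open>n\<close>, \<open>k\<close>.\<close>
  let ?\<sigma> = "\<lambda>i. if i < m then i else if i < m + n then i + k
    else if i < m + n + k then i - n else i"
  let ?N = "(m + n) + (k + k)"
  let ?gr = "cart_prod ((\<lambda>x. x @ f x) ` X) ((\<lambda>y. y @ y) ` Y)"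
  have "definable M ((m + k) + (n + k))
      {zs \<in> tuples M ((m + k) + (n + k)). map (\<lambda>i. zs ! ?\<sigma> i) [0..<?N] \<in> ?gr}"
    by (intro definable_pullback definable_cart_prod gr definable_diagonal[OF Y]) auto
  also have "{zs \<in> tuples M ((m + k) + (n + k)). map (\<lambda>i. zs ! ?\<sigma> i) [0..<?N] \<in> ?gr} =
      (\<lambda>z. z @ F z) ` cart_prod X Y" (is "?L = ?R")
  proof -
    have perm: "map (\<lambda>i. ((x @ y) @ (u @ v)) ! ?\<sigma> i) [0..<?N] = (x @ u) @ (y @ v)"
      if "length x = m" "length y = k" "length u = n" "length v = k" for x y u v :: "'a list"
    proof (rule nth_equalityI)
      fix i assume "i < length (map (\<lambda>i. ((x @ y) @ (u @ v)) ! ?\<sigma> i) [0..<?N])"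
      then have i: "i < ?N" by simp
      then consider "i < m" | j where "i = m + j" "j < n" | j where "i = m + n + j" "j < k"
        | j where "i = m + n + k + j" "j < k"
        by (metis add.assoc add_less_cancel_left le_Suc_ex not_le)
      then show "map (\<lambda>i. ((x @ y) @ (u @ v)) ! ?\<sigma> i) [0..<?N] ! i = ((x @ u) @ (y @ v)) ! i"
        using i that by cases (simp_all add: nth_append)
    qed (use that in simp)
    have "zs \<in> ?R" if "zs \<in> ?L" for zs
    proof -
      from that obtain z w where zw: "zs = z @ w" "z \<in> tuples M (m + k)" "w \<in> tuples M (n + k)"
        using tuples_append_cases by (metis (no_types, lifting) mem_Collect_eq)
      obtain x y where xy: "z = x @ y" "x \<in> tuples M m" "y \<in> tuples M k"
        using zw(2) by (rule tuples_append_cases)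
      obtain u v where uv: "w = u @ v" "u \<in> tuples M n" "v \<in> tuples M k"
        using zw(3) by (rule tuples_append_cases)
      have l: "length x = m" "length y = k" "length u = n" "length v = k"
        using xy uv by (auto simp: tuples_def)
      have "(x @ u) @ (y @ v) \<in> ?gr"
        using conjunct2[OF CollectD[OF that]] unfolding zw(1) xy(1) uv(1) perm[OF l] .
      then obtain x' y' where "x' \<in> X" "y' \<in> Y" "(x @ u) @ (y @ v) = (x' @ f x') @ (y' @ y')"
        unfolding cart_prod_def by blast
      moreover from this have "x = x' \<and> u = f x' \<and> y = y' \<and> v = y'"
        using l lX[of x'] lX'[OF fX, of x'] lY[of y'] by (simp add: append_eq_append_conv)
      ultimately have "zs = (x' @ y') @ F (x' @ y')" "x' @ y' \<in> cart_prod X Y"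
        using F by (auto simp: zw xy uv cart_prod_def)
      then show "zs \<in> ?R" by blast
    qed
    moreover have "zs \<in> ?L" if "zs \<in> ?R" for zs
    proof -
      from that obtain x y where xy: "x \<in> X" "y \<in> Y" "zs = (x @ y) @ (f x @ y)"
        using F by (auto simp: cart_prod_def)
      have "(x @ f x) @ (y @ y) \<in> ?gr"
        using xy unfolding cart_prod_def by blast
      then have "map (\<lambda>i. zs ! ?\<sigma> i) [0..<?N] \<in> ?gr"
        unfolding xy(3) perm[OF lX[OF xy(1)] lY[OF xy(2)] lX'[OF fX[OF xy(1)]] lY[OF xy(2)]] .
      moreover have "zs \<in> tuples M ((m + k) + (n + k))"
        using xy fX[OF xy(1)] definable_subset[OF X] definable_subset[OF X'] definable_subset[OF Y]
        by (auto simp: tuples_def subset_iff)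
      ultimately show ?thesis by blast
    qed
    ultimately show ?thesis by blast
  qed
  finally have graph: "definable M ((m + k) + (n + k)) ((\<lambda>z. z @ F z) ` cart_prod X Y)" .
  have "bij_betw F (cart_prod X Y) (cart_prod X' Y)"
  proof (rule bij_betwI')
    fix z z' assume "z \<in> cart_prod X Y" "z' \<in> cart_prod X Y"
    then obtain x y x' y' where xy: "z = x @ y" "x \<in> X" "z' = x' @ y'" "x' \<in> X"
      unfolding cart_prod_def by blast
    have "f x @ y = f x' @ y' \<longleftrightarrow> f x = f x' \<and> y = y'"
      using lX'[OF fX[OF xy(2)]] lX'[OF fX[OF xy(4)]] by simp
    moreover have "f x = f x' \<longleftrightarrow> x = x'"
      using f xy by (auto simp: bij_betw_def inj_on_eq_iff)
    ultimately show "F z = F z' \<longleftrightarrow> z = z'"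
      using F xy lX[OF xy(2)] lX[OF xy(4)] by simp
  next
    fix z assume "z \<in> cart_prod X Y"
    then obtain x y where "z = x @ y" "x \<in> X" "y \<in> Y"
      unfolding cart_prod_def by blast
    then show "F z \<in> cart_prod X' Y"
      using fX F unfolding cart_prod_def by auto
  next
    fix w assume "w \<in> cart_prod X' Y"
    then obtain x' y where y: "x' \<in> X'" "y \<in> Y" "w = x' @ y"
      unfolding cart_prod_def by blast
    then obtain x where "x \<in> X" "x' = f x"
      using f by (auto simp: bij_betw_def)
    with y have "w = F (x @ y)" "x @ y \<in> cart_prod X Y"
      using F by (auto simp: cart_prod_def)
    then show "\<exists>z \<in> cart_prod X Y. w = F z" by blast
  qed
  then show ?thesis
    unfolding definably_isomorphic_def
    using definable_cart_prod[OF X Y] definable_cart_prod[OF X' Y] graph by blast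
qed

section \<open>Sets with trivial class\<close>

definition relation_group :: "('a, 'f, 'r) fo_struct \<Rightarrow> ('a list set \<Rightarrow>\<^sub>0 int) set" where
  "relation_group M = generate (free_Abelian_group (Def M)) (grothendieck_relations M)"

text \<open>A set is null if its class in the Grothendieck group is zero. Working with this predicate,
instead of with classes, keeps the whole computation at the level of definable sets.\<close>

definition null :: "('a, 'f, 'r) fo_struct \<Rightarrow> 'a list set \<Rightarrow> bool" where
  "null M X \<longleftrightarrow> frag_of X \<in> relation_group M"

lemma keys_grothendieck_relations:
  assumes "a \<in> grothendieck_relations M"
  shows "Poly_Mapping.keys a \<subseteq> Def M"
proof -
  have diff: "Poly_Mapping.keys (frag_of X - b) \<subseteq> Def M"
    if "definable M n X" "Poly_Mapping.keys b \<subseteq> Def M" for n X and b :: "'a list set \<Rightarrow>\<^sub>0 int"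
    using that keys_diff[of "frag_of X" b] by (auto simp: Def_def)
  show ?thesis
    using assms unfolding grothendieck_relations_def
  proof (elim UnE CollectE exE conjE)
    fix X Y assume "a = frag_of X - frag_of Y" "definably_isomorphic M X Y"
    then show ?thesis
      using diff[of _ X "frag_of Y"] by (auto simp: definably_isomorphic_def Def_def)
  next
    fix X Y n
    assume a: "a = frag_of (X \<union> Y) - (frag_of X + frag_of Y)"
      and XY: "definable M n X" "definable M n Y"
    have "Poly_Mapping.keys (frag_of X + frag_of Y) \<subseteq> Def M"
      using keys_add[of "frag_of X" "frag_of Y"] XY by (auto simp: Def_def)
    then show ?thesis
      using diff[OF definable_Un[OF XY]] by (simp add: a)
  qed
qed

lemma subgroup_relation_group: "subgroup (relation_group M) (free_Abelian_group (Def M))"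
  unfolding relation_group_def
  by (rule group.generate_is_subgroup) (auto dest: keys_grothendieck_relations)

lemma relation_group_closed:
  shows "0 \<in> relation_group M"
    and "a \<in> relation_group M \<Longrightarrow> b \<in> relation_group M \<Longrightarrow> a + b \<in> relation_group M"
    and "a \<in> relation_group M \<Longrightarrow> - a \<in> relation_group M"
    and "a \<in> relation_group M \<Longrightarrow> b \<in> relation_group M \<Longrightarrow> a - b \<in> relation_group M"
proof -
  interpret subgroup "relation_group M" "free_Abelian_group (Def M)"
    by (rule subgroup_relation_group)
  show "0 \<in> relation_group M" using one_closed by simp
  show add: "a + b \<in> relation_group M" if "a \<in> relation_group M" "b \<in> relation_group M" for a b
    using m_closed[OF that] by simp
  show minus: "- a \<in> relation_group M" if "a \<in> relation_group M" for a
    using m_inv_closed[OF that] mem_carrier[OF that] by simp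
  show "a - b \<in> relation_group M" if "a \<in> relation_group M" "b \<in> relation_group M"
    using add[OF that(1) minus[OF that(2)]] by simp
qed

lemma iso_relation:
  assumes "definably_isomorphic M X Y"
  shows "frag_of X - frag_of Y \<in> relation_group M"
  unfolding relation_group_def grothendieck_relations_def
  using assms by (blast intro: generate.incl)

lemma disjoint_relation:
  assumes "definable M n X" "definable M n Y" "X \<inter> Y = {}"
  shows "frag_of (X \<union> Y) - (frag_of X + frag_of Y) \<in> relation_group M"
  unfolding relation_group_def grothendieck_relations_def
  using assms by (blast intro: generate.incl)

lemma null_iso:
  assumes "definably_isomorphic M X Y" "null M X"
  shows "null M Y"
  using relation_group_closed(4)[OF assms(2)[unfolded null_def] iso_relation[OF assms(1)]]
  by (simp add: null_def)

lemma null_Un: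
  assumes "definable M n X" "definable M n Y" "X \<inter> Y = {}" "null M X" "null M Y"
  shows "null M (X \<union> Y)"
  using relation_group_closed(2)[OF disjoint_relation[OF assms(1-3)]
      relation_group_closed(2)[OF assms(4,5)[unfolded null_def]]]
  by (simp add: null_def)

lemma null_Diff:
  assumes "definable M n X" "definable M n Y" "Y \<subseteq> X" "null M X" "null M Y"
  shows "null M (X - Y)"
proof -
  have "frag_of ((X - Y) \<union> Y) - (frag_of (X - Y) + frag_of Y) \<in> relation_group M"
    by (intro disjoint_relation[of _ n] definable_Diff assms) auto
  moreover have "(X - Y) \<union> Y = X" using assms by blast
  ultimately have "frag_of X - (frag_of (X - Y) + frag_of Y) \<in> relation_group M" by simp
  from relation_group_closed(4)[OF assms(4)[unfolded null_def]
      relation_group_closed(2)[OF this assms(5)[unfolded null_def]]]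
  show ?thesis by (simp add: null_def)
qed

text \<open>From \<open>[X] = [A] + [B]\<close> and \<open>[X] = [A]\<close>.\<close>

lemma null_complement_of_copy:
  assumes "definable M n X" "definable M n A" "definable M n B" "X = A \<union> B" "A \<inter> B = {}"
    and "definably_isomorphic M X A"
  shows "null M B"
proof -
  have "frag_of X - (frag_of A + frag_of B) \<in> relation_group M"
    using disjoint_relation[of M n A B] assms by simp
  from relation_group_closed(4)[OF iso_relation[OF assms(6)] this]
  show ?thesis by (simp add: null_def)
qed

text \<open>The ideal property of the relation group: multiplication by \<open>[Y]\<close> is additive and maps each
generating relation to a generating relation.\<close>

lemma mult_right_relation_group:
  assumes "definable M k Y" "a \<in> relation_group M"
  shows "frag_extend (\<lambda>X. frag_of (cart_prod X Y)) a \<in> relation_group M" (is "?\<mu> a \<in> _")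
proof -
  have rel: "?\<mu> r \<in> relation_group M" if "r \<in> grothendieck_relations M" for r
    using that unfolding grothendieck_relations_def
  proof (elim UnE CollectE exE conjE)
    fix X X' assume r: "r = frag_of X - frag_of X'" and "definably_isomorphic M X X'"
    then have "definably_isomorphic M (cart_prod X Y) (cart_prod X' Y)"
      using assms(1) by (intro definably_isomorphic_cart_prod)
    then show ?thesis
      using iso_relation by (simp add: r frag_extend_diff)
  next
    fix X X' n assume r: "r = frag_of (X \<union> X') - (frag_of X + frag_of X')"
      and X: "definable M n X" "definable M n X'" "X \<inter> X' = {}"
    have "x = x'" if "x @ y = x' @ y'" "x \<in> X" "x' \<in> X'" for x x' y y'
      using that definable_subset[OF X(1)] definable_subset[OF X(2)]
      by (simp add: tuples_def subset_iff)
    then have "cart_prod X Y \<inter> cart_prod X' Y = {}"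
      using X(3) unfolding cart_prod_def by blast
    moreover have "cart_prod (X \<union> X') Y = cart_prod X Y \<union> cart_prod X' Y"
      by (auto simp: cart_prod_def)
    ultimately show ?thesis
      using disjoint_relation[of M "n + k" "cart_prod X Y" "cart_prod X' Y"]
        definable_cart_prod[OF _ assms(1)] X
      by (simp add: r frag_extend_diff frag_extend_add)
  qed
  from assms(2)[unfolded relation_group_def] show ?thesis
  proof induction
    case one
    then show ?case using relation_group_closed(1) by simp
  next
    case (incl h)
    then show ?case by (rule rel)
  next
    case (inv h)
    then show ?case
      using relation_group_closed(3)[OF rel[OF inv]] keys_grothendieck_relations[OF inv]
      by (simp add: frag_extend_minus)
  next
    case (eng h1 h2)
    then show ?case
      using relation_group_closed(2) by (simp add: frag_extend_add)
  qed
qed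

text \<open>The one-point set \<open>M\<^sup>0\<close> represents \<open>1\<close>, and \<open>1 = 0\<close> kills everything.\<close>

lemma null_if_null_point:
  assumes "null M {[]}" "definable M n Y"
  shows "null M Y"
  using mult_right_relation_group[OF assms(2) assms(1)[unfolded null_def]]
  by (simp add: null_def cart_prod_def)

lemma relation_group_eq_carrier:
  assumes "null M {[]}"
  shows "relation_group M = carrier (free_def_ring M)"
proof
  show "relation_group M \<subseteq> carrier (free_def_ring M)"
    using subgroup.subset[OF subgroup_relation_group] by (simp add: free_def_ring_def)
  show "carrier (free_def_ring M) \<subseteq> relation_group M"
  proof
    fix a assume "a \<in> carrier (free_def_ring M)"
    then have "Poly_Mapping.keys a \<subseteq> Def M" by (simp add: free_def_ring_def)
    then show "a \<in> relation_group M"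
      by (rule free_Abelian_group_induct)
        (auto simp: Def_def relation_group_closed null_def[symmetric] null_if_null_point[OF assms])
  qed
qed

section \<open>Quotients by the unit ideal\<close>

lemma (in abelian_group) a_rcosets_carrier: "a_rcosets (carrier G) = {carrier G}"
proof -
  have "carrier G +> a = carrier G" if a: "a \<in> carrier G" for a
  proof -
    have "y = (y \<ominus> a) \<oplus> a" "y \<ominus> a \<in> carrier G" if "y \<in> carrier G" for y
      using a that by (simp_all add: minus_eq a_assoc l_neg)
    then show ?thesis
      using a by (auto simp: a_r_coset_def')
  qed
  then show ?thesis
    using zero_closed by (auto simp: A_RCOSETS_def')
qed

text \<open>Both quotients have a single element, and the ring axioms of \<open>S Quot carrier S\<close> say that
the operations do not leave it.\<close>

lemma Quot_carrier_iso:
  assumes "abelian_group R" "ring S"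
  shows "R Quot carrier R \<simeq> S Quot carrier S"
proof -
  interpret S: ring S by fact
  interpret Q: ring "S Quot carrier S"
    by (rule ideal.quotient_is_ring[OF S.oneideal])
  have R: "carrier (R Quot carrier R) = {carrier R}"
    using abelian_group.a_rcosets_carrier[OF assms(1)] by (simp add: FactRing_def)
  have S: "carrier (S Quot carrier S) = {carrier S}"
    using S.a_rcosets_carrier by (simp add: FactRing_def)
  let ?h = "\<lambda>_. carrier S"
  have "?h \<in> ring_iso (R Quot carrier R) (S Quot carrier S)"
  proof (rule ring_iso_memI)
    show "bij_betw ?h (carrier (R Quot carrier R)) (carrier (S Quot carrier S))"
      by (simp add: R S bij_betw_def)
  qed (use Q.m_closed Q.a_closed Q.one_closed S in auto)
  then show ?thesis unfolding is_ring_iso_def by blast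
qed

lemma abelian_group_free_def_ring: "abelian_group (free_def_ring M)"
proof -
  have "comm_group (add_monoid (free_def_ring M))"
    using abelian_free_Abelian_group[of "Def M"]
    by (simp add: free_def_ring_def free_Abelian_group_def)
  then show ?thesis by (rule comm_group_abelian_groupI)
qed

lemma ring_target_ring: "ring (target_ring q)"
proof -
  interpret UP_cring "ZFact q" "UP (ZFact q)"
    using ZFact_is_cring by (simp add: UP_cring_def)
  let ?P = "UP (ZFact q)"
  have "poly_T q \<in> carrier ?P"
    by (simp add: poly_T_def)
  then have "ideal (Idl\<^bsub>?P\<^esub> {poly_T q \<oplus>\<^bsub>?P\<^esub> poly_T q [^]\<^bsub>?P\<^esub> (2::nat)}) ?P"
    by (intro P.genideal_ideal) simp
  then show ?thesis
    unfolding target_ring_def by (rule ideal.quotient_is_ring)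
qed

section \<open>Linear conditions over a group of rational numbers\<close>

lemma ordered_group_struct_simps [simp]:
  "universe (ordered_group_struct G) = G"
  "fun_arity (ordered_group_struct G) f = 2"
  "rel_arity (ordered_group_struct G) r = 2"
  "fun_interp (ordered_group_struct G) f xs = xs ! 0 + xs ! 1"
  "rel_interp (ordered_group_struct G) r xs \<longleftrightarrow> xs ! 0 < xs ! 1"
  by (simp_all add: ordered_group_struct_def)

locale rational_subgroup =
  fixes G :: "rat set"
  assumes zero_closed: "0 \<in> G"
    and add_closed: "x \<in> G \<Longrightarrow> y \<in> G \<Longrightarrow> x + y \<in> G"
    and uminus_closed: "x \<in> G \<Longrightarrow> - x \<in> G"
begin

abbreviation M :: "(rat, og_fun, og_rel) fo_struct" where
  "M \<equiv> ordered_group_struct G"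

lemma diff_closed: "x \<in> G \<Longrightarrow> y \<in> G \<Longrightarrow> x - y \<in> G"
  using add_closed uminus_closed by fastforce

lemma of_int_mult_closed:
  assumes "x \<in> G"
  shows "of_int n * x \<in> G"
proof (induction n rule: int_induct[of _ 0])
  case base
  show ?case using zero_closed by simp
next
  case (step1 i)
  then show ?case using add_closed assms by (simp add: algebra_simps)
next
  case (step2 i)
  then show ?case using diff_closed assms by (simp add: algebra_simps)
qed

lemmas closed = zero_closed add_closed uminus_closed diff_closed of_int_mult_closed

end

text \<open>Linear forms with integer coefficients. The language has neither negation nor
zero, so in general such a form is only a difference of two terms.\<close>

inductive linear_form :: "nat \<Rightarrow> (rat list \<Rightarrow> rat) \<Rightarrow> bool" for n where
  coordinate: "i < n \<Longrightarrow> linear_form n (\<lambda>xs. xs ! i)"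
| add: "linear_form n f \<Longrightarrow> linear_form n g \<Longrightarrow> linear_form n (\<lambda>xs. f xs + g xs)"
| diff: "linear_form n f \<Longrightarrow> linear_form n g \<Longrightarrow> linear_form n (\<lambda>xs. f xs - g xs)"

lemma linear_form_of_int_mult:
  assumes "linear_form n f"
  shows "linear_form n (\<lambda>xs. of_int k * f xs)"
proof (induction k rule: int_induct[of _ 0])
  case base
  show ?case using linear_form.diff[OF assms assms] by simp
next
  case (step1 i)
  then show ?case using linear_form.add[OF _ assms] by (fastforce simp: algebra_simps)
next
  case (step2 i)
  then show ?case using linear_form.diff[OF _ assms] by (fastforce simp: algebra_simps)
qed

lemmas linear_form_intros = linear_form.intros linear_form_of_int_mult

context rational_subgroup
begin

text \<open>The list \<open>ys\<close> leaves room for parameters behind the variables. A coordinate \<open>x\<close> is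
the difference of \<open>x + x\<close> and \<open>x\<close>, which avoids a constant for zero.\<close>

lemma linear_form_terms:
  assumes "linear_form n f"
  obtains s t where "\<And>k. k \<ge> n \<Longrightarrow> wf_term M k s" "\<And>k. k \<ge> n \<Longrightarrow> wf_term M k t"
    "\<And>xs ys. length xs = n \<Longrightarrow> eval_term M (xs @ ys) s = eval_term M (xs @ ys) t + f xs"
proof -
  have "\<exists>s t. (\<forall>k\<ge>n. wf_term M k s) \<and> (\<forall>k\<ge>n. wf_term M k t) \<and> (\<forall>xs ys. length xs = n \<longrightarrow>
      eval_term M (xs @ ys) s = eval_term M (xs @ ys) t + f xs)"
    using assms
  proof induction
    case (coordinate i)
    show ?case
      by (rule exI[of _ "App Plus [Var i, Var i]"], rule exI[of _ "Var i"])
        (use coordinate in \<open>auto simp: nth_append\<close>)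
  next
    case (add f g)
    then obtain s t s' t' where
      "\<forall>k\<ge>n. wf_term M k s" "\<forall>k\<ge>n. wf_term M k t"
      "\<forall>xs ys. length xs = n \<longrightarrow> eval_term M (xs @ ys) s = eval_term M (xs @ ys) t + f xs"
      "\<forall>k\<ge>n. wf_term M k s'" "\<forall>k\<ge>n. wf_term M k t'"
      "\<forall>xs ys. length xs = n \<longrightarrow> eval_term M (xs @ ys) s' = eval_term M (xs @ ys) t' + g xs"
      by blast
    note terms = this
    show ?case
      by (rule exI[of _ "App Plus [s, s']"], rule exI[of _ "App Plus [t, t']"])
        (use terms in auto)
  next
    case (diff f g)
    then obtain s t s' t' where
      "\<forall>k\<ge>n. wf_term M k s" "\<forall>k\<ge>n. wf_term M k t"
      "\<forall>xs ys. length xs = n \<longrightarrow> eval_term M (xs @ ys) s = eval_term M (xs @ ys) t + f xs"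
      "\<forall>k\<ge>n. wf_term M k s'" "\<forall>k\<ge>n. wf_term M k t'"
      "\<forall>xs ys. length xs = n \<longrightarrow> eval_term M (xs @ ys) s' = eval_term M (xs @ ys) t' + g xs"
      by blast
    note terms = this
    show ?case
      by (rule exI[of _ "App Plus [s, t']"], rule exI[of _ "App Plus [t, s']"])
        (use terms in auto)
  qed
  then show thesis using that by blast
qed

lemma definable_linear_less:
  assumes "linear_form n f" "b \<in> G"
  shows "definable M n {xs \<in> tuples M n. f xs < b}"
proof -
  obtain s t where wf: "\<And>k. k \<ge> n \<Longrightarrow> wf_term M k s" "\<And>k. k \<ge> n \<Longrightarrow> wf_term M k t"
    and f: "\<And>xs ys. length xs = n \<Longrightarrow> eval_term M (xs @ ys) s = eval_term M (xs @ ys) t + f xs"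
    using linear_form_terms[OF assms(1)] by blast
  show ?thesis
  proof (rule definableI)
    show "set [b] \<subseteq> universe M" using assms(2) by simp
    show "wf_formula M (n + length [b]) (Rel Less [s, App Plus [t, Var n]])"
      using wf by simp
    fix xs assume "xs \<in> tuples M n"
    then show "xs \<in> {xs \<in> tuples M n. f xs < b} \<longleftrightarrow>
        sat M (xs @ [b]) (Rel Less [s, App Plus [t, Var n]])"
      using f[of xs "[b]"] by (auto simp: tuples_def)
  qed auto
qed

lemma definable_linear_equal:
  assumes "linear_form n f" "b \<in> G"
  shows "definable M n {xs \<in> tuples M n. f xs = b}"
proof -
  obtain s t where wf: "\<And>k. k \<ge> n \<Longrightarrow> wf_term M k s" "\<And>k. k \<ge> n \<Longrightarrow> wf_term M k t"
    and f: "\<And>xs ys. length xs = n \<Longrightarrow> eval_term M (xs @ ys) s = eval_term M (xs @ ys) t + f xs"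
    using linear_form_terms[OF assms(1)] by blast
  show ?thesis
  proof (rule definableI)
    show "set [b] \<subseteq> universe M" using assms(2) by simp
    show "wf_formula M (n + length [b]) (Equal s (App Plus [t, Var n]))"
      using wf by simp
    fix xs assume "xs \<in> tuples M n"
    then show "xs \<in> {xs \<in> tuples M n. f xs = b} \<longleftrightarrow>
        sat M (xs @ [b]) (Equal s (App Plus [t, Var n]))"
      using f[of xs "[b]"] by (auto simp: tuples_def)
  qed auto
qed

section \<open>Regions of the plane and affine maps\<close>

definition region :: "(rat \<Rightarrow> rat \<Rightarrow> bool) \<Rightarrow> rat list set" where
  "region P = {[x, y] | x y. x \<in> G \<and> y \<in> G \<and> P x y}"

lemma region_eq: "region P = {xs \<in> tuples M 2. P (xs ! 0) (xs ! 1)}"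
proof
  show "region P \<subseteq> {xs \<in> tuples M 2. P (xs ! 0) (xs ! 1)}"
    by (auto simp: region_def tuples_def)
  have "xs = [xs ! 0, xs ! 1]" if "length xs = 2" for xs :: "rat list"
    using that by (intro nth_equalityI) (auto simp: less_2_cases_iff)
  moreover have "xs ! 0 \<in> G" "xs ! 1 \<in> G" if "xs \<in> tuples M 2" for xs
    using that nth_mem[of 0 xs] nth_mem[of 1 xs]
    by (auto simp: tuples_def)
  ultimately show "{xs \<in> tuples M 2. P (xs ! 0) (xs ! 1)} \<subseteq> region P"
    unfolding region_def tuples_def by blast
qed

lemma region_cong:
  assumes "\<And>x y. x \<in> G \<Longrightarrow> y \<in> G \<Longrightarrow> P x y \<longleftrightarrow> Q x y"
  shows "region P = region Q"
  using assms unfolding region_def by blast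

lemma definable_halfplane:
  assumes "\<And>x y. P x y \<longleftrightarrow> of_int i * x + of_int j * y < b" "b \<in> G"
  shows "definable M 2 (region P)"
proof -
  have "linear_form 2 (\<lambda>xs. of_int i * (xs ! 0) + of_int j * (xs ! 1))"
    by (intro linear_form_intros) auto
  from definable_linear_less[OF this assms(2)] show ?thesis
    unfolding region_eq assms(1) .
qed

lemma definable_region_conj:
  assumes "definable M 2 (region P)" "definable M 2 (region Q)"
  shows "definable M 2 (region (\<lambda>x y. P x y \<and> Q x y))"
proof -
  have "region (\<lambda>x y. P x y \<and> Q x y) = region P \<inter> region Q"
    by (auto simp: region_def)
  then show ?thesis using definable_Int[OF assms] by simp
qed

lemma definable_region_not:
  assumes "definable M 2 (region P)"
  shows "definable M 2 (region (\<lambda>x y. \<not> P x y))"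
proof -
  have "region (\<lambda>x y. \<not> P x y) = tuples M 2 - region P"
    unfolding region_eq by blast
  then show ?thesis using definable_Diff[OF definable_tuples assms] by simp
qed

text \<open>The graph is cut out by two linear equations in four variables, and injectivity is Cramer's rule.
Surjectivity has to be assumed, since the inverse matrix need not be integral.\<close>

lemma affine_map_iso:
  fixes i j k l :: int
  assumes P: "definable M 2 (region P)" and Q: "definable M 2 (region Q)"
    and c: "c \<in> G" "d \<in> G" and det: "i * l - j * k \<noteq> 0"
    and to: "\<And>x y. x \<in> G \<Longrightarrow> y \<in> G \<Longrightarrow> P x y \<Longrightarrow>
      Q (of_int i * x + of_int j * y + c) (of_int k * x + of_int l * y + d)"
    and onto: "\<And>u v. u \<in> G \<Longrightarrow> v \<in> G \<Longrightarrow> Q u v \<Longrightarrow> \<exists>x\<in>G. \<exists>y\<in>G. P x y \<and>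
      u = of_int i * x + of_int j * y + c \<and> v = of_int k * x + of_int l * y + d"
  shows "definably_isomorphic M (region P) (region Q)"
proof -
  let ?u = "\<lambda>x y. of_int i * x + of_int j * y + c"
  let ?v = "\<lambda>x y. of_int k * x + of_int l * y + d"
  define f where "f = (\<lambda>xs. [?u (xs ! 0) (xs ! 1), ?v (xs ! 0) (xs ! 1)])"
  have inj: "x = x' \<and> y = y'" if "of_int i * x + of_int j * y = of_int i * x' + of_int j * y'"
      "of_int k * x + of_int l * y = of_int k * x' + of_int l * y'" for x y x' y' :: rat
  proof -
    have e: "of_int i * (x - x') + of_int j * (y - y') = 0"
      "of_int k * (x - x') + of_int l * (y - y') = 0"
      using that by (simp_all add: algebra_simps)
    have "of_int (i * l - j * k) * (x - x') =
        of_int l * (of_int i * (x - x') + of_int j * (y - y')) -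
        of_int j * (of_int k * (x - x') + of_int l * (y - y'))"
      "of_int (i * l - j * k) * (y - y') =
        of_int i * (of_int k * (x - x') + of_int l * (y - y')) -
        of_int k * (of_int i * (x - x') + of_int j * (y - y'))"
      by (simp_all add: algebra_simps)
    then have "of_int (i * l - j * k) * (x - x') = 0" "of_int (i * l - j * k) * (y - y') = 0"
      unfolding e by simp_all
    then show ?thesis using det by (metis eq_iff_diff_eq_0 mult_eq_0_iff of_int_eq_0_iff)
  qed
  have "bij_betw f (region P) (region Q)"
    unfolding bij_betw_def
  proof
    show "inj_on f (region P)"
    proof (rule inj_onI)
      fix z w assume "z \<in> region P" "w \<in> region P" "f z = f w"
      then show "z = w"
        by (auto simp: region_def f_def dest: inj)
    qed
    have "f z \<in> region Q" if "z \<in> region P" for z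
      using that to c closed by (auto simp: region_def f_def)
    moreover have "w \<in> f ` region P" if w: "w \<in> region Q" for w
    proof -
      obtain u v where uv: "w = [u, v]" "u \<in> G" "v \<in> G" "Q u v"
        using w by (auto simp: region_def)
      obtain x y where "x \<in> G" "y \<in> G" "P x y" "u = ?u x y" "v = ?v x y"
        using onto[OF uv(2-4)] by blast
      then have "[x, y] \<in> region P" "w = f [x, y]"
        by (auto simp: region_def f_def uv(1))
      then show ?thesis by blast
    qed
    ultimately show "f ` region P = region Q" by blast
  qed
  moreover have "definable M (2 + 2) ((\<lambda>z. z @ f z) ` region P)"
  proof -
    let ?g = "\<lambda>zs. zs ! 2 - of_int i * (zs ! 0) - of_int j * (zs ! 1)"
    let ?h = "\<lambda>zs. zs ! 3 - of_int k * (zs ! 0) - of_int l * (zs ! 1)"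
    have "definable M (2 + 2) (cart_prod (region P) (region Q) \<inter>
        ({zs \<in> tuples M (2 + 2). ?g zs = c} \<inter> {zs \<in> tuples M (2 + 2). ?h zs = d}))"
      by (intro definable_Int definable_cart_prod definable_linear_equal linear_form_intros P Q c)
        auto
    also have "cart_prod (region P) (region Q) \<inter>
        ({zs \<in> tuples M (2 + 2). ?g zs = c} \<inter> {zs \<in> tuples M (2 + 2). ?h zs = d}) =
        (\<lambda>z. z @ f z) ` region P" (is "?L = ?R")
    proof
      show "?L \<subseteq> ?R"
        by (auto simp: cart_prod_def region_def f_def eval_nat_numeral image_iff algebra_simps)
      have "z @ f z \<in> ?L" if z: "z \<in> region P" for z
      proof -
        obtain x y where xy: "z = [x, y]" "x \<in> G" "y \<in> G" "P x y"
          using z by (auto simp: region_def)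
        then have "f z \<in> region Q"
          using to c closed by (auto simp: region_def f_def)
        then have "z @ f z \<in> cart_prod (region P) (region Q)"
          using z by (auto simp: cart_prod_def)
        moreover have "z @ f z \<in> tuples M (2 + 2)"
          using definable_subset[OF definable_cart_prod[OF P Q]] calculation by blast
        ultimately show ?thesis
          by (simp add: xy(1) f_def eval_nat_numeral)
      qed
      then show "?R \<subseteq> ?L" by blast
    qed
    finally show ?thesis .
  qed
  ultimately show ?thesis
    unfolding definably_isomorphic_def using P Q by blast
qed

lemma null_region_disj:
  assumes "definable M 2 (region P)" "definable M 2 (region Q)"
    and "null M (region P)" "null M (region Q)" "\<And>x y. \<not> (P x y \<and> Q x y)"
  shows "definable M 2 (region (\<lambda>x y. P x y \<or> Q x y))" "null M (region (\<lambda>x y. P x y \<or> Q x y))"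
proof -
  have "region (\<lambda>x y. P x y \<or> Q x y) = region P \<union> region Q" "region P \<inter> region Q = {}"
    using assms(5) by (auto simp: region_def)
  then show "definable M 2 (region (\<lambda>x y. P x y \<or> Q x y))" "null M (region (\<lambda>x y. P x y \<or> Q x y))"
    using definable_Un[OF assms(1,2)] null_Un[OF assms(1,2) _ assms(3,4)] by auto
qed

section \<open>Cones in the plane\<close>

text \<open>The affine map \<open>(x, y) \<mapsto> (c - k y, x)\<close> is a bijection of the plane over a
\<open>k\<close>-divisible group. For \<open>k = 1\<close> and \<open>c = 0\<close> it is the rotation by a right
angle; for \<open>k = p - 1\<close> and \<open>c = a\<close> it permutes the four quadrants at the point
\<open>(a/p, a/p)\<close> cyclically, when \<open>a/p\<close> is outside the group.\<close>

lemma null_rotation: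
  assumes P: "definable M 2 (region P)" and Q: "definable M 2 (region Q)"
    and k: "k \<noteq> 0" "\<And>x. x \<in> G \<Longrightarrow> \<exists>y\<in>G. of_int k * y = x" and c: "c \<in> G"
    and PQ: "\<And>x y. Q (c - of_int k * y) x \<longleftrightarrow> P x y"
    and null: "null M (region P)"
  shows "null M (region Q)"
proof -
  have "definably_isomorphic M (region P) (region Q)"
  proof (rule affine_map_iso[where i = "0" and j = "- k" and k = "1" and l = "0"
        and c = "c" and d = "0"])
    fix x y assume "x \<in> G" "y \<in> G" "P x y"
    then show "Q (of_int 0 * x + of_int (- k) * y + c) (of_int 1 * x + of_int 0 * y + 0)"
      using PQ[of y x] by simp
  next
    fix u v assume uv: "u \<in> G" "v \<in> G" "Q u v"
    obtain y where y: "y \<in> G" "of_int k * y = c - u"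
      using k(2) diff_closed[OF c uv(1)] by blast
    show "\<exists>x\<in>G. \<exists>y\<in>G. P x y \<and> u = of_int 0 * x + of_int (- k) * y + c \<and>
        v = of_int 1 * x + of_int 0 * y + 0"
      by (rule bexI[of _ v], rule bexI[of _ y]) (use uv y PQ[of y v] in auto)
  qed (use P Q k(1) c zero_closed in auto)
  then show ?thesis using null by (rule null_iso)
qed

lemma definable_bounds:
  assumes "b \<in> G"
  shows "definable M 2 (region (\<lambda>x y. of_int k * x > b))"
    and "definable M 2 (region (\<lambda>x y. of_int k * y > b))"
    and "definable M 2 (region (\<lambda>x y. of_int k * x < b))"
    and "definable M 2 (region (\<lambda>x y. of_int k * y < b))"
proof -
  have b: "- b \<in> G" using uminus_closed assms .
  show "definable M 2 (region (\<lambda>x y. of_int k * x > b))"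
    by (rule definable_halfplane[of _ "- k" 0, OF _ b]) auto
  show "definable M 2 (region (\<lambda>x y. of_int k * y > b))"
    by (rule definable_halfplane[of _ 0 "- k", OF _ b]) auto
  show "definable M 2 (region (\<lambda>x y. of_int k * x < b))"
    by (rule definable_halfplane[of _ k 0, OF _ assms]) auto
  show "definable M 2 (region (\<lambda>x y. of_int k * y < b))"
    by (rule definable_halfplane[of _ 0 k, OF _ assms]) auto
qed

text \<open>Write \<open>p = k + 1\<close>. The quadrant at \<open>(2a/p, a/p)\<close> is cut by the line
\<open>x - y = a/p\<close>, which contains no point of \<open>G\<^sup>2\<close>, into two pieces. The piece next to the
vertical side is a copy of the whole quadrant, and the other one is a copy of the quadrant at
\<open>(a/p, a/p)\<close>, so the class of the latter vanishes.\<close>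

lemma null_corner:
  assumes a: "a \<in> G" and indivisible: "\<And>x. x \<in> G \<Longrightarrow> of_int (k + 1) * x \<noteq> a"
    and k: "k > 0" "\<And>x. x \<in> G \<Longrightarrow> \<exists>y\<in>G. of_int k * y = x"
  shows "null M (region (\<lambda>x y. of_int (k + 1) * x > a \<and> of_int (k + 1) * y > a))"
proof -
  let ?p = "of_int (k + 1) :: rat"
  let ?X = "\<lambda>x y. ?p * x > 2 * a \<and> ?p * y > a"
  let ?W = "\<lambda>x y. ?p * x > a \<and> ?p * y > a"
  let ?far = "\<lambda>x y. ?X x y \<and> ?p * (x - y) > a"
  let ?near = "\<lambda>x y. ?X x y \<and> ?p * (x - y) < a"
  have a2: "2 * a \<in> G" using of_int_mult_closed[OF a, of 2] by simp
  have X: "definable M 2 (region ?X)" and W: "definable M 2 (region ?W)"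
    by (intro definable_region_conj definable_bounds a a2)+
  have "definable M 2 (region (\<lambda>x y. ?p * (x - y) < a))"
    by (rule definable_halfplane[of _ "k + 1" "- (k + 1)", OF _ a]) (simp add: algebra_simps)
  then have near: "definable M 2 (region ?near)"
    by (rule definable_region_conj[OF X])
  have "definable M 2 (region (\<lambda>x y. ?p * (x - y) > a))"
    by (rule definable_halfplane[of _ "- (k + 1)" "k + 1", OF _ uminus_closed[OF a]])
      (auto simp: algebra_simps)
  then have far: "definable M 2 (region ?far)"
    by (rule definable_region_conj[OF X])
  have kpos: "of_int k > (0 :: rat)" using k by simp
  \<comment> \<open>The map \<open>(x, y) \<mapsto> (x, x + k y - a)\<close>. It fixes the first coordinate and sends the
  side \<open>y = a/p\<close> to the line \<open>y = x - a/p\<close>, because \<open>k a/p - a = - a/p\<close>.\<close>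
  have X_near: "definably_isomorphic M (region ?X) (region ?near)"
  proof (rule affine_map_iso[where i = "1" and j = "0" and k = "1" and l = "k"
        and c = "0" and d = "- a"])
    have key: "a < ?p * (x + of_int k * y - a) \<and> ?p * (x - (x + of_int k * y - a)) < a"
      if "?X x y" for x y
    proof -
      have "0 < of_int k * (?p * y - a)" using that kpos by simp
      then show ?thesis using that by (simp add: algebra_simps)
    qed
    fix x y assume "?X x y"
    then show "?near (of_int 1 * x + of_int 0 * y + 0) (of_int 1 * x + of_int k * y + - a)"
      using key[of x y] by simp
  next
    fix u v assume uv: "u \<in> G" "v \<in> G" "?near u v"
    obtain y where y: "y \<in> G" "of_int k * y = v - u + a"
      using k(2)[OF add_closed[OF diff_closed[OF uv(2,1)] a]] by blast
    have "of_int k * (?p * y - a) = ?p * (of_int k * y) - of_int k * a"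
      by (simp add: algebra_simps)
    also have "\<dots> = a - ?p * (u - v)"
      unfolding y(2) by (simp add: algebra_simps)
    finally have "of_int k * (?p * y - a) > 0" using uv by simp
    then have y_gt: "?p * y > a" using kpos by (simp add: zero_less_mult_iff)
    show "\<exists>x\<in>G. \<exists>y\<in>G. ?X x y \<and> u = of_int 1 * x + of_int 0 * y + 0 \<and>
        v = of_int 1 * x + of_int k * y + - a"
      by (rule bexI[of _ u], rule bexI[of _ y]) (use uv y y_gt in auto)
  qed (use X near k a closed in auto)
  have "null M (region ?far)"
  proof (rule null_complement_of_copy[OF X near far _ _ X_near])
    have "?p * (x - y) \<noteq> a" if "x \<in> G" "y \<in> G" for x y
      using indivisible[OF diff_closed[OF that]] .
    then show "region ?X = region ?near \<union> region ?far"
      by (force simp: region_def)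
    show "region ?near \<inter> region ?far = {}"
      by (auto simp: region_def)
  qed
  \<comment> \<open>The shear \<open>(x, y) \<mapsto> (x - y, y)\<close>; the bound \<open>x > 2a/p\<close> is implied by the
  other two.\<close>
  moreover have "definably_isomorphic M (region ?far) (region ?W)"
  proof (rule affine_map_iso[where i = "1" and j = "- 1" and k = "0" and l = "1"
        and c = "0" and d = "0"])
    fix u v assume uv: "u \<in> G" "v \<in> G" "?W u v"
    show "\<exists>x\<in>G. \<exists>y\<in>G. ?far x y \<and> u = of_int 1 * x + of_int (- 1) * y + 0 \<and>
        v = of_int 0 * x + of_int 1 * y + 0"
      by (rule bexI[of _ "u + v"], rule bexI[of _ v])
        (use uv add_closed in \<open>auto simp: algebra_simps\<close>)
  qed (use far W closed in auto)
  ultimately show ?thesis using null_iso by blast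
qed

text \<open>The four quadrants at \<open>(a/p, a/p)\<close> cover the plane, since no point has a coordinate
\<open>a/p\<close>, and they are copies of each other.\<close>

lemma null_plane:
  assumes a: "a \<in> G" and indivisible: "\<And>x. x \<in> G \<Longrightarrow> of_int (k + 1) * x \<noteq> a"
    and k: "k > 0" "\<And>x. x \<in> G \<Longrightarrow> \<exists>y\<in>G. of_int k * y = x"
  shows "null M (region (\<lambda>x y. True))"
proof -
  let ?p = "of_int (k + 1) :: rat"
  let ?Q1 = "\<lambda>x y. ?p * x > a \<and> ?p * y > a"
  let ?Q2 = "\<lambda>x y. ?p * x < a \<and> ?p * y > a"
  let ?Q3 = "\<lambda>x y. ?p * x < a \<and> ?p * y < a"
  let ?Q4 = "\<lambda>x y. ?p * x > a \<and> ?p * y < a"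
  have D: "definable M 2 (region ?Q1)" "definable M 2 (region ?Q2)"
    "definable M 2 (region ?Q3)" "definable M 2 (region ?Q4)"
    by (intro definable_region_conj definable_bounds a)+
  have kpos: "of_int k > (0 :: rat)" using k by simp
  have flip: "?p * (a - of_int k * y) - a = of_int k * (a - ?p * y)" for y
    by (simp add: algebra_simps)
  have flip_less: "?p * (a - of_int k * y) < a \<longleftrightarrow> ?p * y > a"
    and flip_greater: "?p * (a - of_int k * y) > a \<longleftrightarrow> ?p * y < a" for y
    using kpos flip[of y] mult_less_0_iff[of "of_int k" "a - ?p * y"]
      zero_less_mult_iff[of "of_int k" "a - ?p * y"] by linarith+
  have k0: "k \<noteq> 0" using k by simp
  have 1: "null M (region ?Q1)"
    using null_corner[OF a indivisible k] .
  have 2: "null M (region ?Q2)"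
    by (rule null_rotation[OF D(1,2) k0 k(2) a _ 1]) (unfold flip_less flip_greater, auto)
  have 3: "null M (region ?Q3)"
    by (rule null_rotation[OF D(2,3) k0 k(2) a _ 2]) (unfold flip_less flip_greater, auto)
  have 4: "null M (region ?Q4)"
    by (rule null_rotation[OF D(3,4) k0 k(2) a _ 3]) (unfold flip_less flip_greater, auto)
  note D12 = null_region_disj[OF D(1,2) 1 2]
  note D34 = null_region_disj[OF D(3,4) 3 4]
  have "null M (region (\<lambda>x y. (?Q1 x y \<or> ?Q2 x y) \<or> (?Q3 x y \<or> ?Q4 x y)))"
    by (rule null_region_disj[OF D12(1) D34(1) D12(2) D34(2)]) auto
  also have "region (\<lambda>x y. (?Q1 x y \<or> ?Q2 x y) \<or> (?Q3 x y \<or> ?Q4 x y)) = region (\<lambda>x y. True)"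
  proof (rule region_cong)
    fix x y assume "x \<in> G" "y \<in> G"
    then have "?p * x < a \<or> ?p * x > a" "?p * y < a \<or> ?p * y > a"
      using indivisible by (meson linorder_neqE_linordered_idom)+
    then show "((?Q1 x y \<or> ?Q2 x y) \<or> (?Q3 x y \<or> ?Q4 x y)) \<longleftrightarrow> True" by blast
  qed
  finally show ?thesis .
qed

lemma definable_signs:
  "definable M 2 (region (\<lambda>x y. 0 < x))" "definable M 2 (region (\<lambda>x y. 0 < y))"
  "definable M 2 (region (\<lambda>x y. x < 0))" "definable M 2 (region (\<lambda>x y. y < 0))"
  "definable M 2 (region (\<lambda>x y. 0 \<le> x))" "definable M 2 (region (\<lambda>x y. 0 \<le> y))"
  "definable M 2 (region (\<lambda>x y. x \<le> 0))" "definable M 2 (region (\<lambda>x y. y \<le> 0))"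
  "definable M 2 (region (\<lambda>x y. y < x))" "definable M 2 (region (\<lambda>x y. x \<le> y))"
proof -
  note S = definable_bounds[OF zero_closed, of 1, simplified]
  show "definable M 2 (region (\<lambda>x y. 0 < x))" "definable M 2 (region (\<lambda>x y. 0 < y))"
    "definable M 2 (region (\<lambda>x y. x < 0))" "definable M 2 (region (\<lambda>x y. y < 0))"
    by (rule S)+
  show "definable M 2 (region (\<lambda>x y. 0 \<le> x))" "definable M 2 (region (\<lambda>x y. 0 \<le> y))"
    "definable M 2 (region (\<lambda>x y. x \<le> 0))" "definable M 2 (region (\<lambda>x y. y \<le> 0))"
    using S[THEN definable_region_not] by (simp_all add: not_less)
  show L: "definable M 2 (region (\<lambda>x y. y < x))"
    by (rule definable_halfplane[of _ "- 1" 1, OF _ zero_closed]) auto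
  show "definable M 2 (region (\<lambda>x y. x \<le> y))"
    using definable_region_not[OF L] by (simp add: not_less)
qed

text \<open>The diagonal divides it into two pieces, each of which is a sheared copy of the whole; so its
class \<open>H\<close> satisfies \<open>H = 2 H\<close>. The half-open shape puts every ray on the
right side: a closed or an open quadrant would lose or gain a ray.\<close>

lemma null_half_open_quadrant: "null M (region (\<lambda>x y. 0 < x \<and> 0 \<le> y))"
proof -
  let ?H = "\<lambda>x y. 0 < x \<and> 0 \<le> (y :: rat)"
  let ?below = "\<lambda>x y. ?H x y \<and> y < (x :: rat)"
  let ?above = "\<lambda>x y. ?H x y \<and> x \<le> (y :: rat)"
  have D: "definable M 2 (region ?H)" "definable M 2 (region ?below)"
    "definable M 2 (region ?above)"
    by (intro definable_region_conj definable_signs)+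
  have "definably_isomorphic M (region ?H) (region ?below)"
  proof (rule affine_map_iso[where i = "1" and j = "1" and k = "0" and l = "1"
        and c = "0" and d = "0"])
    fix u v assume uv: "u \<in> G" "v \<in> G" "?below u v"
    show "\<exists>x\<in>G. \<exists>y\<in>G. ?H x y \<and> u = of_int 1 * x + of_int 1 * y + 0 \<and>
        v = of_int 0 * x + of_int 1 * y + 0"
      by (rule bexI[of _ "u - v"], rule bexI[of _ v]) (use uv diff_closed in auto)
  qed (use D zero_closed in auto)
  moreover have "region ?H = region ?below \<union> region ?above" "region ?below \<inter> region ?above = {}"
    unfolding region_eq by auto
  ultimately have "null M (region ?above)"
    using null_complement_of_copy[OF D] by blast
  moreover have "definably_isomorphic M (region ?above) (region ?H)"
  proof (rule affine_map_iso[where i = "1" and j = "0" and k = "- 1" and l = "1"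
        and c = "0" and d = "0"])
    fix u v assume uv: "u \<in> G" "v \<in> G" "?H u v"
    show "\<exists>x\<in>G. \<exists>y\<in>G. ?above x y \<and> u = of_int 1 * x + of_int 0 * y + 0 \<and>
        v = of_int (- 1) * x + of_int 1 * y + 0"
      by (rule bexI[of _ u], rule bexI[of _ "u + v"]) (use uv add_closed in auto)
  qed (use D zero_closed in auto)
  ultimately show ?thesis using null_iso by blast
qed

text \<open>It is the disjoint union of the four rotated copies of a half-open quadrant.\<close>

lemma null_punctured_plane: "null M (region (\<lambda>x y. \<not> (x = 0 \<and> y = 0)))"
proof -
  let ?Q1 = "\<lambda>x y. 0 < x \<and> 0 \<le> (y :: rat)"
  let ?Q2 = "\<lambda>x y. x \<le> 0 \<and> 0 < (y :: rat)"
  let ?Q3 = "\<lambda>x y. x < 0 \<and> (y :: rat) \<le> 0"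
  let ?Q4 = "\<lambda>x y. 0 \<le> x \<and> (y :: rat) < 0"
  have D: "definable M 2 (region ?Q1)" "definable M 2 (region ?Q2)"
    "definable M 2 (region ?Q3)" "definable M 2 (region ?Q4)"
    by (intro definable_region_conj definable_signs)+
  note rotation = null_rotation[of _ _ 1 0]
  have 1: "null M (region ?Q1)"
    by (rule null_half_open_quadrant)
  have 2: "null M (region ?Q2)"
    by (rule rotation[OF D(1,2) _ _ _ _ 1]) (auto simp: zero_closed)
  have 3: "null M (region ?Q3)"
    by (rule rotation[OF D(2,3) _ _ _ _ 2]) (auto simp: zero_closed)
  have 4: "null M (region ?Q4)"
    by (rule rotation[OF D(3,4) _ _ _ _ 3]) (auto simp: zero_closed)
  note D12 = null_region_disj[OF D(1,2) 1 2]
  note D34 = null_region_disj[OF D(3,4) 3 4]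
  have "null M (region (\<lambda>x y. (?Q1 x y \<or> ?Q2 x y) \<or> (?Q3 x y \<or> ?Q4 x y)))"
    by (rule null_region_disj[OF D12(1) D34(1) D12(2) D34(2)]) auto
  also have "region (\<lambda>x y. (?Q1 x y \<or> ?Q2 x y) \<or> (?Q3 x y \<or> ?Q4 x y)) =
      region (\<lambda>x y. \<not> (x = 0 \<and> y = 0))"
    by (rule region_cong) auto
  finally show ?thesis .
qed

lemma null_point:
  assumes "null M (region (\<lambda>x y. True))"
  shows "null M {[]}"
proof -
  have plane: "definable M 2 (region (\<lambda>x y. True))"
    using definable_tuples by (simp add: region_eq)
  have origin: "region (\<lambda>x y. True) - region (\<lambda>x y. \<not> (x = 0 \<and> y = 0)) = {[0, 0]}"
    using zero_closed by (auto simp: region_def)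
  have "definable M 2 (region (\<lambda>x y. (0 \<le> x \<and> x \<le> 0) \<and> (0 \<le> y \<and> y \<le> 0)))"
    by (intro definable_region_conj definable_signs)
  then have "definable M 2 (region (\<lambda>x y. \<not> ((0 \<le> x \<and> x \<le> 0) \<and> (0 \<le> y \<and> y \<le> 0))))"
    by (rule definable_region_not)
  also have "(\<lambda>x y. \<not> ((0 \<le> x \<and> x \<le> 0) \<and> (0 \<le> y \<and> y \<le> (0 :: rat)))) =
      (\<lambda>x y. \<not> (x = (0 :: rat) \<and> y = 0))"
    by (intro ext) auto
  finally have punctured: "definable M 2 (region (\<lambda>x y. \<not> (x = 0 \<and> y = 0)))" .
  have "definable M 2 {[0, 0]}"
    using definable_Diff[OF plane punctured] unfolding origin .
  moreover have "definable M 0 {[]}"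
    using definable_tuples[of M 0] by (simp add: tuples_def cong: conj_cong)
  ultimately have "definable M 2 {[0, 0]} \<and> definable M 0 {[]} \<and>
      bij_betw (\<lambda>_. []) {[0, 0 :: rat]} {[] :: rat list} \<and>
      definable M (2 + 0) ((\<lambda>z. z @ []) ` {[0, 0]})"
    by (auto simp: bij_betw_def)
  then have "definably_isomorphic M {[0, 0]} {[]}"
    unfolding definably_isomorphic_def by blast
  moreover have "null M {[0, 0]}"
    using null_Diff[OF plane punctured _ assms null_punctured_plane]
    unfolding origin by (auto simp: region_def)
  ultimately show ?thesis by (rule null_iso)
qed

section \<open>Divisibility of subgroups of the rational numbers\<close>

lemma of_nat_divisible:
  assumes "n > 0" "\<And>p. Factorial_Ring.prime p \<Longrightarrow> p dvd n \<Longrightarrow> p_divisible p G" "x \<in> G"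
  shows "\<exists>y\<in>G. of_nat n * y = x"
  using assms
proof (induction n arbitrary: x rule: less_induct)
  case (less n)
  show ?case
  proof (cases "n = 1")
    case True
    then show ?thesis using less.prems by auto
  next
    case False
    then obtain p where p: "Factorial_Ring.prime p" "p dvd n"
      using prime_factor_nat by blast
    then obtain m where m: "n = p * m" by (auto elim: dvdE)
    obtain z where z: "z \<in> G" "of_nat p * z = x"
      using less.prems(2)[OF p] less.prems(3) by (auto simp: p_divisible_def)
    have "m < n" "m > 0" using m less.prems(1) prime_gt_1_nat[OF p(1)] by auto
    then obtain y where "y \<in> G" "of_nat m * y = z"
      using less.IH[of m z] less.prems(2) m z(1) by auto
    then show ?thesis using m z by (intro bexI[of _ y]) (auto simp: mult.assoc)
  qed
qed

text \<open>A nonzero group that is divisible by every prime is a rational vector space.\<close>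

lemma indivisible_prime_exists:
  assumes "G \<noteq> {0}" "G \<noteq> UNIV"
  shows "\<exists>p. Factorial_Ring.prime p \<and> \<not> p_divisible p G"
proof (rule ccontr)
  assume "\<not> ?thesis"
  then have div: "\<exists>y\<in>G. of_nat n * y = x" if "n > 0" "x \<in> G" for n x
    using of_nat_divisible that by blast
  obtain g where g: "g \<in> G" "g \<noteq> 0" using assms(1) zero_closed by blast
  have "r \<in> G" for r
  proof -
    obtain i j where ij: "r / g = of_int i / of_int j" "j > 0"
      by (metis Rat_cases_nonzero Fract_of_int_quotient divide_eq_0_iff of_int_0 of_int_1 zero_less_one)
    obtain y where y: "y \<in> G" "of_nat (nat j) * y = g"
      using div[of "nat j" g] ij(2) g(1) by auto
    have "r = of_int i * y"
      using ij y(2) g(2) by (auto simp: field_simps)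
    then show ?thesis using of_int_mult_closed y(1) by simp
  qed
  then show False using assms(2) by blast
qed

text \<open>The prime \<open>p\<close> is chosen least among those by which \<open>G\<close> is not divisible, so that
\<open>G\<close> is divisible by all prime factors of \<open>p - 1\<close>, hence by \<open>p - 1\<close>.\<close>

lemma grothendieck_group_trivial:
  assumes "G \<noteq> {0}" "G \<noteq> UNIV"
  shows "relation_group M = carrier (free_def_ring M)"
proof -
  define p where "p = (LEAST p. Factorial_Ring.prime p \<and> \<not> p_divisible p G)"
  have p: "Factorial_Ring.prime p" "\<not> p_divisible p G"
    using LeastI_ex[OF indivisible_prime_exists[OF assms]] unfolding p_def by auto
  have p_least: "p_divisible l G" if "Factorial_Ring.prime l" "l < p" for l
    using not_less_Least[of l] that unfolding p_def by blast
  define k where "k = int p - 1"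
  have p1: "p > 1" using prime_gt_1_nat[OF p(1)] .
  have pk: "of_int (k + 1) = (of_nat p :: rat)" by (simp add: k_def)
  have kn: "of_int k = (of_nat (p - 1) :: rat)" using p1 by (simp add: k_def of_nat_diff)
  obtain a where a: "a \<in> G" "\<And>x. x \<in> G \<Longrightarrow> of_int (k + 1) * x \<noteq> a"
    using p(2) unfolding p_divisible_def pk by blast
  have "k > 0" using p1 by (simp add: k_def)
  moreover have "\<exists>y\<in>G. of_int k * y = x" if "x \<in> G" for x
    unfolding kn
  proof (rule of_nat_divisible)
    fix l assume "Factorial_Ring.prime l" "l dvd p - 1"
    then show "p_divisible l G" using p_least p1 dvd_imp_le[of l "p - 1"] by simp
  qed (use p1 that in auto)
  ultimately have "null M (region (\<lambda>x y. True))"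
    using null_plane[OF a] by blast
  then show ?thesis by (intro relation_group_eq_carrier null_point)
qed

end

section \<open>The Grothendieck ring as a quotient\<close>

theorem theorem1p1:
  fixes G :: "rat set" and S_G :: "nat set" and q :: int
  assumes "subgroup G rational_group"
    and "G \<noteq> {0}"
    and "G \<noteq> UNIV"
    and "S_G = {p. Factorial_Ring.prime p \<and> p_divisible p G}"
    and "q = (GREATEST d. odd d \<and> (\<forall>p. Factorial_Ring.prime p \<and> p \<notin> S_G \<longrightarrow> d dvd int p - 1))"
  shows "\<exists>J. ideal J (target_ring q) \<and>
    grothendieck_ring (ordered_group_struct G) \<simeq> target_ring q Quot J"
proof -
  interpret S: subgroup G rational_group by fact
  have inv: "inv\<^bsub>rational_group\<^esub> x = - x" for x :: rat
    unfolding m_inv_def by (rule the_equality) (auto simp: rational_group_def)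
  interpret rational_subgroup G
    by unfold_locales
      (use S.one_closed S.m_closed S.m_inv_closed inv in \<open>auto simp: rational_group_def\<close>)
  let ?J = "carrier (target_ring q)"
  have "grothendieck_ring (ordered_group_struct G) =
      free_def_ring M Quot carrier (free_def_ring M)"
    unfolding grothendieck_ring_def
    using grothendieck_group_trivial[OF assms(2,3)] by (simp add: relation_group_def)
  then have "grothendieck_ring (ordered_group_struct G) \<simeq> target_ring q Quot ?J"
    using Quot_carrier_iso[OF abelian_group_free_def_ring ring_target_ring] by simp
  then show ?thesis using ring.oneideal[OF ring_target_ring] by blast
qed

end
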